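(* With the mesh $h>0$ fixed, $\widehat\theta^{(N)}\to\theta$ almost surely as $N\to\infty$.
   Context: Fix a mesh $h>0$, an integer $m\ge1$ and known Hurst parameters $H_1,\dots,H_m\in(1/2,1)$. Let $B^{H_1},\dots,B^{H_m}$ be independent fractional Brownian motions on one probability space, i.e. independent centred continuous Gaussian processes with $B^{H_r}(0)=0$ and $\mathbb E[B^{H_r}(t)B^{H_r}(s)]=\frac12(t^{2H_r}+s^{2H_r}-|t-s|^{2H_r})$ for $s,t\ge0$. For $\theta\in\mathbb R$ and $\alpha>0$ set $Z(t)=\theta t+\alpha\sum_{r=1}^m B^{H_r}(t)$ and $t_k=kh$. For $N\ge1$ let $\mathbf T_N=(t_1,\dots,t_N)^\top$, $\mathbf Z^{(N)}=(Z(t_1),\dots,Z(t_N))^\top$, and let $\Gamma_{H,N}$ be the $N\times N$ positive definite matrix with entries $\frac12\sum_{r=1}^m(t_i^{2H_r}+t_j^{2H_r}-|t_i-t_j|^{2H_r})$. Put $\widehat\theta^{(N)}=\mathbf T_N^\top\Gamma_{H,N}^{-1}\mathbf Z^{(N)}/(\mathbf T_N^\top\Gamma_{H,N}^{-1}\mathbf T_N)$. *)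

theory Defs
  imports "HOL-Probability.Probability" "Jordan_Normal_Form.Gauss_Jordan_Elimination"
begin

(* The library density normal_density is only meaningful for positive standard deviation, so
   point masses (normal laws of variance zero) are listed separately. *)
definition gaussian_rv :: "'a measure \<Rightarrow> ('a \<Rightarrow> real) \<Rightarrow> bool" where
  "gaussian_rv M X \<longleftrightarrow> X \<in> borel_measurable M \<and>
     ((\<exists>\<mu> \<sigma>. \<sigma> > 0 \<and> distributed M lborel X (normal_density \<mu> \<sigma>)) \<or>
      (\<exists>\<mu>. AE \<omega> in M. X \<omega> = \<mu>))"

(* Joint normality of the finite-dimensional marginals: every finite linear combination is a
   (possibly degenerate) normal variable. *)
definition gaussian_process :: "'a measure \<Rightarrow> 't set \<Rightarrow> ('t \<Rightarrow> 'a \<Rightarrow> real) \<Rightarrow> bool" where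
  "gaussian_process M I X \<longleftrightarrow>
     (\<forall>J c. finite J \<longrightarrow> J \<subseteq> I \<longrightarrow> gaussian_rv M (\<lambda>\<omega>. \<Sum>t\<in>J. c t * X t \<omega>))"

(* Path properties are required almost surely, which includes processes having them surely.
   Values of X at negative times are irrelevant. *)
definition fractional_brownian_motion :: "'a measure \<Rightarrow> real \<Rightarrow> (real \<Rightarrow> 'a \<Rightarrow> real) \<Rightarrow> bool" where
  "fractional_brownian_motion M H X \<longleftrightarrow>
     gaussian_process M {0..} X \<and>
     (\<forall>t\<ge>0. integral\<^sup>L M (X t) = 0) \<and>
     (AE \<omega> in M. continuous_on {0..} (\<lambda>t. X t \<omega>)) \<and>
     (AE \<omega> in M. X 0 \<omega> = 0) \<and>
     (\<forall>s\<ge>0. \<forall>t\<ge>0. integral\<^sup>L M (\<lambda>\<omega>. X t \<omega> * X s \<omega>)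
        = (t powr (2 * H) + s powr (2 * H) - \<bar>t - s\<bar> powr (2 * H)) / 2)"

(* Mutual independence of the processes as random elements of the product space of functions on
   the half-line {0..}. *)
definition independent_processes ::
  "'a measure \<Rightarrow> 'i set \<Rightarrow> ('i \<Rightarrow> real \<Rightarrow> 'a \<Rightarrow> real) \<Rightarrow> bool" where
  "independent_processes M I B \<longleftrightarrow>
     prob_space.indep_vars M (\<lambda>_. \<Pi>\<^sub>M t\<in>{0..}. borel) (\<lambda>r \<omega>. \<lambda>t\<in>{0..}. B r t \<omega>) I"

definition drifted_mixed_fbm ::
  "real \<Rightarrow> real \<Rightarrow> nat \<Rightarrow> (nat \<Rightarrow> real \<Rightarrow> 'a \<Rightarrow> real) \<Rightarrow> real \<Rightarrow> 'a \<Rightarrow> real" where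
  "drifted_mixed_fbm \<theta> \<alpha> m B t \<omega> = \<theta> * t + \<alpha> * (\<Sum>r=1..m. B r t \<omega>)"

definition mesh_time :: "real \<Rightarrow> nat \<Rightarrow> real" where
  "mesh_time h k = real k * h"

(* Vector and matrix indices start at 0 in the library, hence the successors. *)
definition time_vec :: "real \<Rightarrow> nat \<Rightarrow> real Matrix.vec" where
  "time_vec h N = Matrix.vec N (\<lambda>i. mesh_time h (Suc i))"

definition obs_vec :: "real \<Rightarrow> (real \<Rightarrow> 'a \<Rightarrow> real) \<Rightarrow> nat \<Rightarrow> 'a \<Rightarrow> real Matrix.vec" where
  "obs_vec h Z N \<omega> = Matrix.vec N (\<lambda>i. Z (mesh_time h (Suc i)) \<omega>)"

definition cov_mat :: "real \<Rightarrow> nat \<Rightarrow> (nat \<Rightarrow> real) \<Rightarrow> nat \<Rightarrow> real Matrix.mat" where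
  "cov_mat h m H N = Matrix.mat N N (\<lambda>(i, j).
     let s = mesh_time h (Suc i); t = mesh_time h (Suc j)
     in (\<Sum>r=1..m. s powr (2 * H r) + t powr (2 * H r) - \<bar>s - t\<bar> powr (2 * H r)) / 2)"

(* mat_inverse returns None for a singular matrix; the covariance matrices here are positive
   definite, so the value extracted is the genuine inverse. *)
definition theta_hat ::
  "real \<Rightarrow> nat \<Rightarrow> (nat \<Rightarrow> real) \<Rightarrow> (real \<Rightarrow> 'a \<Rightarrow> real) \<Rightarrow> nat \<Rightarrow> 'a \<Rightarrow> real" where
  "theta_hat h m H Z N \<omega> =
     (let T = time_vec h N; G = the (mat_inverse (cov_mat h m H N))
      in scalar_prod T (G *\<^sub>v obs_vec h Z N \<omega>) / scalar_prod T (G *\<^sub>v T))"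

end

theory Submission
  imports Defs "Jordan_Normal_Form.Determinant"
begin

text \<open>
  Write \<open>\<Gamma>\<close> for the covariance matrix, \<open>T\<close> for the vector of observation times and
  \<open>D = T \<bullet> \<Gamma>\<inverse> T\<close>. The error of the estimator is \<open>\<alpha>\<close> times the sum over \<open>r\<close> of the centred
  Gaussian variables \<open>c \<bullet> (B r (t i))\<^sub>i\<close> with \<open>c = \<Gamma>\<inverse> T / D\<close>. As \<open>\<Gamma>\<close> is the sum of the covariance
  matrices of the individual processes, the variances of these variables add up to \<open>1 / D\<close>.
  Cauchy-Schwarz, tested on the last observation alone, gives
  \<open>1 / D \<le> \<Gamma>\<^sub>N\<^sub>N / T\<^sub>N\<^sup>2 = O(N powr q)\<close> with \<open>q = 2 max H - 2 < 0\<close>. Even moments of centred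
  Gaussian variables are proportional to powers of the variance, so for large \<open>k\<close> the moments of
  order \<open>2 k\<close> are summable in \<open>N\<close>, which forces almost sure convergence to zero.

  That \<open>\<Gamma>\<close> is invertible follows from the spectral representation
  \<open>\<bar>x\<bar> powr (2 * H) * K = \<integral> (1 - cos (x * u)) * u powr (- 1 - 2 * H)\<close> over \<open>u > 0\<close>: a null vector
  of \<open>\<Gamma>\<close> would yield a nonzero polynomial vanishing on an arc of the unit circle.
\<close>

unbundle no inner_syntax
unbundle no vec_syntax

section \<open>Positive definiteness of the covariance of fractional Brownian motion\<close>

definition fbm_cov :: "real \<Rightarrow> real \<Rightarrow> real \<Rightarrow> real" where
  "fbm_cov H s t = (s powr (2 * H) + t powr (2 * H) - \<bar>s - t\<bar> powr (2 * H)) / 2"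

text \<open>Up to a constant, the spectral density of fractional Brownian motion. The half-line u >
  0 suffices because the integrands below are even; the value 0 elsewhere turns integrals over
  \<open>lborel\<close> into integrals over that half-line.\<close>

definition spectral_weight :: "real \<Rightarrow> real \<Rightarrow> real" where
  "spectral_weight H u = (if u > 0 then u powr (- 1 - 2 * H) else 0)"

lemma spectral_weight_nonneg: "spectral_weight H u \<ge> 0"
  by (simp add: spectral_weight_def)

lemma borel_measurable_spectral_weight [measurable]: "spectral_weight H \<in> borel_measurable borel"
  unfolding spectral_weight_def [abs_def] by measurable

text \<open>Bridges gauge and Lebesgue integrals: nonnegativity makes the integral absolute, and
  Borel measurability brings it from the completed measure back to \<open>lborel\<close>.\<close>

lemma integrable_lborel_indicator_times:
  fixes f :: "real \<Rightarrow> real"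
  assumes "(f has_integral I) S" and "\<And>x. x \<in> S \<Longrightarrow> 0 \<le> f x"
    and [measurable]: "f \<in> borel_measurable borel" "S \<in> sets borel"
  shows "integrable lborel (\<lambda>x. indicator S x * f x)"
proof -
  have "f absolutely_integrable_on S"
    using assms by (intro nonnegative_absolutely_integrable_1) (auto simp: integrable_on_def)
  then have "integrable lebesgue (\<lambda>x. indicator S x * f x)"
    by (simp add: set_integrable_def)
  then show ?thesis
    by (subst (asm) integrable_completion) auto
qed

lemma one_minus_cos_le: "1 - cos x \<le> x\<^sup>2 / (2::real)"
proof -
  have "1 - cos x = 2 * (sin (x / 2))\<^sup>2"
    using cos_double_sin [of "x / 2"] by simp
  also have "\<dots> \<le> 2 * (x / 2)\<^sup>2"
    using abs_sin_x_le_abs_x [of "x / 2"] abs_le_square_iff [of "sin (x / 2)" "x / 2"] by linarith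
  finally show ?thesis by (simp add: power2_eq_square)
qed

text \<open>Near 0 the bound 1 - cos y \<le> y^2 / 2 leaves the exponent 1 - 2H, integrable as H <
  1; on u \<ge> 1 the bound 2 leaves -1 - 2H, integrable as H > 0.\<close>

lemma integrable_one_minus_cos_spectral_weight:
  assumes "0 < H" "H < 1"
  shows "integrable lborel (\<lambda>u. (1 - cos (x * u)) * spectral_weight H u)"
proof -
  let ?g = "\<lambda>u::real. x\<^sup>2 / 2 * (indicator {0..1} u * u powr (1 - 2 * H)) +
    2 * (indicator {1..} u * u powr (- 1 - 2 * H))"
  have 1: "integrable lborel (\<lambda>u::real. indicator {0..1} u * u powr (1 - 2 * H))"
    by (rule integrable_lborel_indicator_times [OF has_integral_powr_from_0]) (use assms in auto)
  have 2: "integrable lborel (\<lambda>u::real. indicator {1..} u * u powr (- 1 - 2 * H))"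
    by (rule integrable_lborel_indicator_times [OF has_integral_powr_to_inf]) (use assms in auto)
  show ?thesis
  proof (rule Bochner_Integration.integrable_bound)
    show "integrable lborel ?g"
      by (intro Bochner_Integration.integrable_add integrable_mult_right 1 2)
    show "AE u in lborel. norm ((1 - cos (x * u)) * spectral_weight H u) \<le> norm (?g u)"
    proof (rule AE_I2)
      fix u :: real
      have pos: "0 \<le> 1 - cos (x * u)" "1 - cos (x * u) \<le> 2"
        using cos_le_one [of "x * u"] cos_ge_minus_one [of "x * u"] by linarith+
      consider "u \<le> 0" | "0 < u" "u < 1" | "u \<ge> 1" by linarith
      then have "(1 - cos (x * u)) * spectral_weight H u \<le> ?g u"
      proof cases
        case 2
        have "(1 - cos (x * u)) * spectral_weight H u \<le> (x * u)\<^sup>2 / 2 * spectral_weight H u"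
          by (intro mult_right_mono one_minus_cos_le spectral_weight_nonneg)
        also have "u\<^sup>2 * u powr (- 1 - 2 * H) = u powr (1 - 2 * H)"
          using 2 by (simp flip: powr_numeral powr_add)
        then have "(x * u)\<^sup>2 / 2 * spectral_weight H u = x\<^sup>2 / 2 * u powr (1 - 2 * H)"
          using 2 by (simp add: spectral_weight_def power_mult_distrib mult.assoc)
        finally show ?thesis using 2 by simp
      next
        case 3
        then have "0 \<le> x\<^sup>2 / 2 * (indicator {0..1} u * u powr (1 - 2 * H))"
          by simp
        moreover have "(1 - cos (x * u)) * spectral_weight H u \<le> 2 * u powr (- 1 - 2 * H)"
          using 3 pos by (auto simp: spectral_weight_def intro: mult_right_mono)
        moreover have "indicator {1..} u = (1::real)"
          using 3 by simp
        ultimately show ?thesis by (simp only: mult_1)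
      qed (simp add: spectral_weight_def)
      moreover have "0 \<le> (1 - cos (x * u)) * spectral_weight H u"
        using pos spectral_weight_nonneg by simp
      ultimately show "norm ((1 - cos (x * u)) * spectral_weight H u) \<le> norm (?g u)"
        by (simp only: real_norm_def)
    qed
  qed measurable
qed

lemma cos_abs_eq: "cos (\<bar>x\<bar> * u) = cos (x * u)" for x u :: real
  by (simp add: abs_if)

text \<open>Scaling: replacing u by |x| u gives the Jacobian |x|, and the weight contributes
  |x|^(-1-2H), together |x|^(-2H).\<close>

lemma integral_one_minus_cos_spectral_weight:
  assumes "0 < H" "H < 1"
  shows "(\<integral>u. (1 - cos (x * u)) * spectral_weight H u \<partial>lborel) =
    \<bar>x\<bar> powr (2 * H) * (\<integral>u. (1 - cos u) * spectral_weight H u \<partial>lborel)"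
proof (cases "x = 0")
  case False
  have "(\<integral>u. (1 - cos u) * spectral_weight H u \<partial>lborel) =
      \<bar>x\<bar> * (\<integral>u. (1 - cos (\<bar>x\<bar> * u)) * spectral_weight H (\<bar>x\<bar> * u) \<partial>lborel)"
    using lborel_integral_real_affine [of "\<bar>x\<bar>" "\<lambda>u. (1 - cos u) * spectral_weight H u" 0] False
    by simp
  also have "(\<lambda>u. (1 - cos (\<bar>x\<bar> * u)) * spectral_weight H (\<bar>x\<bar> * u)) =
      (\<lambda>u. \<bar>x\<bar> powr (- 1 - 2 * H) * ((1 - cos (x * u)) * spectral_weight H u))"
    using False
    by (auto simp: fun_eq_iff spectral_weight_def powr_mult zero_less_mult_iff cos_abs_eq)
  also have "\<bar>x\<bar> * (\<integral>u. \<bar>x\<bar> powr (- 1 - 2 * H) * ((1 - cos (x * u)) * spectral_weight H u) \<partial>lborel) =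
      \<bar>x\<bar> powr (- 2 * H) * (\<integral>u. (1 - cos (x * u)) * spectral_weight H u \<partial>lborel)"
    using False powr_mult_base [of "\<bar>x\<bar>" "- 1 - 2 * H"] by simp
  finally show ?thesis
    using False by (simp flip: powr_add mult.assoc)
qed simp

text \<open>The integrand is the real part of (e^(isu) - 1) times the conjugate of (e^(itu) - 1). By
  the addition theorem for \<open>cos\<close> it splits into three terms 1 - cos, at s, t and s - t,
  matching the three powers in \<open>fbm_cov\<close>.\<close>

lemma fbm_cov_spectral:
  assumes "0 < H" "H < 1" and st: "0 \<le> s" "0 \<le> t"
  defines "K \<equiv> \<integral>u. (1 - cos u) * spectral_weight H u \<partial>lborel"
  shows "has_bochner_integral lborel
    (\<lambda>u. ((1 - cos (s * u)) * (1 - cos (t * u)) + sin (s * u) * sin (t * u)) * spectral_weight H u)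
    (2 * K * fbm_cov H s t)"
proof -
  have int: "has_bochner_integral lborel (\<lambda>u. (1 - cos (x * u)) * spectral_weight H u)
      (\<bar>x\<bar> powr (2 * H) * K)" for x
    using integrable_one_minus_cos_spectral_weight [OF assms(1,2), of x]
      integral_one_minus_cos_spectral_weight [OF assms(1,2), of x]
    by (simp add: has_bochner_integral_iff K_def)
  have "has_bochner_integral lborel
    (\<lambda>u. (1 - cos (s * u)) * spectral_weight H u + (1 - cos (t * u)) * spectral_weight H u
       - (1 - cos ((s - t) * u)) * spectral_weight H u)
    (\<bar>s\<bar> powr (2 * H) * K + \<bar>t\<bar> powr (2 * H) * K - \<bar>s - t\<bar> powr (2 * H) * K)"
    by (intro has_bochner_integral_add has_bochner_integral_diff int)
  also have "\<bar>s\<bar> powr (2 * H) * K + \<bar>t\<bar> powr (2 * H) * K - \<bar>s - t\<bar> powr (2 * H) * K =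
      2 * K * fbm_cov H s t"
    using st by (simp add: fbm_cov_def algebra_simps)
  finally show ?thesis
    by (simp add: left_diff_distrib cos_diff algebra_simps)
qed

text \<open>By bilinearity the form becomes the integral of the weighted squared modulus of the sum
  of a_i (e^(i t_i u) - 1), which is visibly nonnegative.\<close>

lemma fbm_quadratic_form_spectral:
  assumes "0 < H" "H < 1" and t: "\<And>i. i \<in> I \<Longrightarrow> 0 \<le> t i"
  defines "K \<equiv> \<integral>u. (1 - cos u) * spectral_weight H u \<partial>lborel"
  shows "has_bochner_integral lborel
    (\<lambda>u. ((\<Sum>i\<in>I. a i * (1 - cos (t i * u)))\<^sup>2 + (\<Sum>i\<in>I. a i * sin (t i * u))\<^sup>2)
        * spectral_weight H u)
    (2 * K * (\<Sum>i\<in>I. \<Sum>j\<in>I. a i * a j * fbm_cov H (t i) (t j)))"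
proof -
  have "has_bochner_integral lborel
    (\<lambda>u. \<Sum>i\<in>I. \<Sum>j\<in>I. a i * a j * (((1 - cos (t i * u)) * (1 - cos (t j * u))
      + sin (t i * u) * sin (t j * u)) * spectral_weight H u))
    (\<Sum>i\<in>I. \<Sum>j\<in>I. a i * a j * (2 * K * fbm_cov H (t i) (t j)))"
    unfolding K_def
    by (intro has_bochner_integral_sum has_bochner_integral_mult_right fbm_cov_spectral assms)
  moreover have "(\<Sum>i\<in>I. \<Sum>j\<in>I. a i * a j * (((1 - cos (t i * u)) * (1 - cos (t j * u))
      + sin (t i * u) * sin (t j * u)) * spectral_weight H u)) =
    ((\<Sum>i\<in>I. a i * (1 - cos (t i * u)))\<^sup>2 + (\<Sum>i\<in>I. a i * sin (t i * u))\<^sup>2)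
        * spectral_weight H u" for u
    unfolding power2_eq_square sum_product
    unfolding sum.distrib [symmetric]
    unfolding sum_distrib_right
    by (intro sum.cong refl) (simp add: algebra_simps)
  moreover have "(\<Sum>i\<in>I. \<Sum>j\<in>I. a i * a j * (2 * K * fbm_cov H (t i) (t j))) =
      2 * K * (\<Sum>i\<in>I. \<Sum>j\<in>I. a i * a j * fbm_cov H (t i) (t j))"
    by (simp add: sum_distrib_left mult_ac)
  ultimately show ?thesis by simp
qed

section \<open>Zeros of trigonometric sums and strict positivity\<close>

lemma infinite_if_AE_lborel:
  assumes "AE u in lborel. P u" "(a::real) < b"
  shows "infinite {u \<in> {a<..<b}. P u}"
proof
  assume "finite {u \<in> {a<..<b}. P u}"
  then have "AE u in lborel. u \<notin> {u \<in> {a<..<b}. P u}"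
    by (intro AE_not_in finite_imp_null_set_lborel)
  with assms(1) have "AE u in lborel. u \<notin> {a<..<b}"
    by eventually_elim auto
  then have "emeasure lborel {a<..<b} = 0"
    by (subst (asm) AE_iff_null_sets [symmetric]) auto
  with assms(2) show False by simp
qed

lemma finite_zeros_trigonometric_sum:
  fixes a :: "nat \<Rightarrow> real"
  assumes "h > 0" "k < N" "a k \<noteq> 0"
  shows "finite {u \<in> {0<..<1 / h}. (\<Sum>i<N. a i * (1 - cos (mesh_time h (Suc i) * u))) = 0 \<and>
    (\<Sum>i<N. a i * sin (mesh_time h (Suc i) * u)) = 0}" (is "finite ?S")
proof -
  \<comment> \<open>The two sums are, up to sign, the real and imaginary parts of \<open>p\<close> at \<open>cis (h * u)\<close>.\<close>
  define p :: "complex poly" where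
    "p = (\<Sum>i<N. Polynomial.monom (of_real (a i)) (Suc i)) - [:of_real (\<Sum>i<N. a i):]"
  \<comment> \<open>The subtracted constant affects only degree 0, so the coefficient at
    \<open>Suc k\<close> is exactly \<open>a k\<close>.\<close>
  have "Polynomial.coeff p (Suc k) = (\<Sum>i<N. if i = k then of_real (a i) else 0)"
    by (simp add: p_def coeff_sum)
  then have "p \<noteq> 0"
    using assms by auto
  then have "finite {z. poly p z = 0}"
    by (rule poly_roots_finite)
  moreover have "(\<lambda>u. cis (h * u)) ` ?S \<subseteq> {z. poly p z = 0}"
  proof clarsimp
    fix u
    assume u: "(\<Sum>i<N. a i * (1 - cos (mesh_time h (Suc i) * u))) = 0"
      "(\<Sum>i<N. a i * sin (mesh_time h (Suc i) * u)) = 0"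
    have "cis (h * u) ^ Suc i = cis (mesh_time h (Suc i) * u)" for i
      unfolding mesh_time_def mult.assoc by (rule Complex.DeMoivre)
    then have "poly p (cis (h * u)) = (\<Sum>i<N. of_real (a i) * (cis (mesh_time h (Suc i) * u) - 1))"
      unfolding p_def poly_diff poly_sum poly_monom
      by (simp add: sum_subtractf right_diff_distrib del: power_Suc)
    also have "\<dots> = 0"
      using u by (auto simp: complex_eq_iff sum_negf [symmetric] right_diff_distrib sum_subtractf)
    finally show "poly p (cis (h * u)) = 0" .
  qed
  ultimately have "finite ((\<lambda>u. cis (h * u)) ` ?S)"
    by (rule rev_finite_subset)
  \<comment> \<open>The interval (0, 1/h) keeps h u inside [0, pi], where \<open>cos\<close> is
    injective, so distinct u give distinct roots.\<close>
  moreover have "inj_on (\<lambda>u. cis (h * u)) ?S"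
  proof (rule inj_onI)
    fix u v assume "u \<in> ?S" "v \<in> ?S" and eq: "cis (h * u) = cis (h * v)"
    then have "0 \<le> h * u" "h * u \<le> pi" "0 \<le> h * v" "h * v \<le> pi"
      using assms(1) pi_gt3 by (auto simp: field_simps)
    moreover have "cos (h * u) = cos (h * v)"
      using eq by (simp add: complex_eq_iff)
    ultimately have "h * u = h * v"
      by (metis arccos_cos)
    then show "u = v" using assms(1) by simp
  qed
  ultimately show ?thesis
    by (rule finite_imageD)
qed

text \<open>A vanishing spectral integral would make the nonnegative integrand zero almost
  everywhere. On (0, 1/h) the weight is positive, so both trigonometric sums would have infinitely
  many common zeros there.\<close>

lemma fbm_cov_pos_def:
  fixes a :: "nat \<Rightarrow> real"
  assumes H: "0 < H" "H < 1" and "h > 0" and "k < N" "a k \<noteq> 0"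
  shows "0 < (\<Sum>i<N. \<Sum>j<N. a i * a j * fbm_cov H (mesh_time h (Suc i)) (mesh_time h (Suc j)))"
    (is "0 < ?Q")
proof -
  define K where "K = (\<integral>u. (1 - cos u) * spectral_weight H u \<partial>lborel)"
  define F where "F u = ((\<Sum>i<N. a i * (1 - cos (mesh_time h (Suc i) * u)))\<^sup>2
    + (\<Sum>i<N. a i * sin (mesh_time h (Suc i) * u))\<^sup>2) * spectral_weight H u" for u
  have F: "integrable lborel F" "integral\<^sup>L lborel F = 2 * K * ?Q"
    using fbm_quadratic_form_spectral [OF H, where I = "{..<N}" and a = a
        and t = "\<lambda>i. mesh_time h (Suc i)"] \<open>h > 0\<close>
    by (simp_all add: has_bochner_integral_iff K_def F_def [abs_def] mesh_time_def)
  have F_nonneg: "0 \<le> F u" for u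
    unfolding F_def by (intro mult_nonneg_nonneg spectral_weight_nonneg) auto
  have "integral\<^sup>L lborel F \<noteq> 0"
  proof
    assume "integral\<^sup>L lborel F = 0"
    then have "AE u in lborel. F u = 0"
      using integral_nonneg_eq_0_iff_AE [OF F(1)] F_nonneg by simp
    then have "infinite {u \<in> {0<..<1 / h}. F u = 0}"
      by (rule infinite_if_AE_lborel) (use \<open>h > 0\<close> in simp)
    moreover have "{u \<in> {0<..<1 / h}. F u = 0} \<subseteq>
      {u \<in> {0<..<1 / h}. (\<Sum>i<N. a i * (1 - cos (mesh_time h (Suc i) * u))) = 0 \<and>
    (\<Sum>i<N. a i * sin (mesh_time h (Suc i) * u)) = 0}"
      by (auto simp: F_def spectral_weight_def sum_power2_eq_zero_iff)
    ultimately show False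
      using finite_zeros_trigonometric_sum [OF assms(3,4), of a] assms(5) finite_subset by blast
  qed
  moreover have "0 \<le> integral\<^sup>L lborel F"
    using F_nonneg by simp
  \<comment> \<open>Positivity of \<open>K\<close> is not proved beforehand: a positive product with
    \<open>K\<close> nonnegative forces both factors to be positive.\<close>
  ultimately have "0 < 2 * K * ?Q"
    unfolding F(2) by linarith
  moreover have "0 \<le> K"
    unfolding K_def by (intro integral_nonneg_AE) (simp add: spectral_weight_nonneg)
  ultimately show ?thesis
    by (simp only: zero_less_mult_iff) linarith
qed

section \<open>Almost sure convergence of Gaussian variables with decaying variance\<close>

text \<open>In the nondegenerate case this is the normal moment formula, rewritten through the
  variance; a centred point mass is almost surely 0.\<close>

lemma (in prob_space) gaussian_rv_even_moment:
  assumes X: "gaussian_rv M X" and mean: "expectation X = 0"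
  shows integrable_gaussian_rv_even_power: "integrable M (\<lambda>\<omega>. X \<omega> ^ (2 * k))"
    and expectation_gaussian_rv_even_power: "expectation (\<lambda>\<omega>. X \<omega> ^ (2 * k)) =
      fact (2 * k) / (2 ^ k * fact k) * expectation (\<lambda>\<omega>. (X \<omega>)\<^sup>2) ^ k"
proof -
  have [measurable]: "X \<in> borel_measurable M"
    using X by (simp add: gaussian_rv_def)
  have "integrable M (\<lambda>\<omega>. X \<omega> ^ (2 * k)) \<and> expectation (\<lambda>\<omega>. X \<omega> ^ (2 * k)) =
      fact (2 * k) / (2 ^ k * fact k) * expectation (\<lambda>\<omega>. (X \<omega>)\<^sup>2) ^ k"
    using X unfolding gaussian_rv_def
  proof (elim conjE disjE exE)
    fix \<mu> \<sigma> :: real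
    assume \<sigma>: "0 < \<sigma>" and D: "distributed M lborel X (normal_density \<mu> \<sigma>)"
    then have "\<mu> = 0"
      using normal_distributed_expectation [OF \<sigma> D] mean by simp
    have density_moment: "integrable lborel (\<lambda>x. normal_density \<mu> \<sigma> x * x ^ (2 * n))"
      "(\<integral>x. normal_density \<mu> \<sigma> x * x ^ (2 * n) \<partial>lborel) =
        fact (2 * n) / ((2 / \<sigma>\<^sup>2) ^ n * fact n)" for n
      using normal_moment_even [OF \<sigma>, of 0 n]
      unfolding has_bochner_integral_iff \<open>\<mu> = 0\<close> diff_0_right by blast+
    have moment: "integrable M (\<lambda>\<omega>. X \<omega> ^ (2 * n))"
      "expectation (\<lambda>\<omega>. X \<omega> ^ (2 * n)) = fact (2 * n) / ((2 / \<sigma>\<^sup>2) ^ n * fact n)" for n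
      using density_moment [of n]
        distributed_integrable [OF D, of "\<lambda>x. x ^ (2 * n)"]
        distributed_integral [OF D, of "\<lambda>x. x ^ (2 * n)"]
      by simp_all
    have "expectation (\<lambda>\<omega>. (X \<omega>)\<^sup>2) = \<sigma>\<^sup>2"
      using moment(2) [of 1] by simp
    then show ?thesis
      using moment [of k] \<sigma> by (simp add: power_divide)
  next
    fix \<mu> assume ae: "AE \<omega> in M. X \<omega> = \<mu>"
    then have "expectation X = expectation (\<lambda>_. \<mu>)"
      by (intro integral_cong_AE) auto
    then have "\<mu> = 0" using mean by (simp add: prob_space)
    \<comment> \<open>Writing the moment as \<open>0 ^ n\<close> covers n = 0 as well, where both
      sides of the moment formula equal 1.\<close>
    have const: "integrable M (\<lambda>\<omega>. X \<omega> ^ n)" "expectation (\<lambda>\<omega>. X \<omega> ^ n) = 0 ^ n" for n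
    proof -
      have *: "AE \<omega> in M. X \<omega> ^ n = 0 ^ n"
        using ae \<open>\<mu> = 0\<close> by auto
      show "integrable M (\<lambda>\<omega>. X \<omega> ^ n)"
        by (subst integrable_cong_AE [OF _ _ *]) auto
      show "expectation (\<lambda>\<omega>. X \<omega> ^ n) = 0 ^ n"
        by (subst integral_cong_AE [OF _ _ *]) (auto simp: prob_space)
    qed
    show ?thesis
      using const [of "2 * k"] const [of 2] by (cases k) auto
  qed
  then show "integrable M (\<lambda>\<omega>. X \<omega> ^ (2 * k))"
    and "expectation (\<lambda>\<omega>. X \<omega> ^ (2 * k)) =
      fact (2 * k) / (2 ^ k * fact k) * expectation (\<lambda>\<omega>. (X \<omega>)\<^sup>2) ^ k"
    by blast+
qed

text \<open>Exchanging sum and integral gives the series of the \<open>Y n\<close> a finite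
  integral, so it converges almost everywhere and its terms tend to 0.\<close>

lemma AE_tendsto_zero_if_summable_integral:
  fixes Y :: "nat \<Rightarrow> 'a \<Rightarrow> real"
  assumes int: "\<And>n. integrable M (Y n)" and nonneg: "\<And>n \<omega>. 0 \<le> Y n \<omega>"
    and summable: "summable (\<lambda>n. integral\<^sup>L M (Y n))"
  shows "AE \<omega> in M. (\<lambda>n. Y n \<omega>) \<longlonglongrightarrow> 0"
proof -
  have [measurable]: "Y n \<in> borel_measurable M" for n
    using int by auto
  have "(\<integral>\<^sup>+\<omega>. (\<Sum>n. ennreal (Y n \<omega>)) \<partial>M) = (\<Sum>n. \<integral>\<^sup>+\<omega>. ennreal (Y n \<omega>) \<partial>M)"
    by (intro nn_integral_suminf) measurable
  also have "\<dots> = (\<Sum>n. ennreal (integral\<^sup>L M (Y n)))"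
    using int nonneg by (simp add: nn_integral_eq_integral)
  also have "\<dots> = ennreal (\<Sum>n. integral\<^sup>L M (Y n))"
    using summable nonneg by (intro suminf_ennreal2) (auto intro: integral_nonneg_AE)
  finally have "(\<integral>\<^sup>+\<omega>. (\<Sum>n. ennreal (Y n \<omega>)) \<partial>M) \<noteq> \<infinity>"
    by simp
  then have "AE \<omega> in M. (\<Sum>n. ennreal (Y n \<omega>)) \<noteq> \<infinity>"
    by (intro nn_integral_PInf_AE) auto
  then show ?thesis
  proof eventually_elim
    fix \<omega> assume "(\<Sum>n. ennreal (Y n \<omega>)) \<noteq> \<infinity>"
    then have "summable (\<lambda>n. Y n \<omega>)"
      using nonneg by (intro summable_suminf_not_top) auto
    then show "(\<lambda>n. Y n \<omega>) \<longlonglongrightarrow> 0"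
      by (rule summable_LIMSEQ_zero)
  qed
qed

lemma tendsto_zero_of_even_power:
  fixes x :: "nat \<Rightarrow> real"
  assumes "(\<lambda>n. x n ^ (2 * k)) \<longlonglongrightarrow> 0" "k > 0"
  shows "x \<longlonglongrightarrow> 0"
proof -
  have "(\<lambda>n. root (2 * k) (x n ^ (2 * k))) \<longlonglongrightarrow> root (2 * k) 0"
    by (intro tendsto_real_root assms)
  moreover have "root (2 * k) (y ^ (2 * k)) = \<bar>y\<bar>" for y :: real
    using real_root_power_cancel [of "2 * k" "\<bar>y\<bar>"] \<open>k > 0\<close> by (simp add: power_even_abs)
  ultimately have "(\<lambda>n. \<bar>x n\<bar>) \<longlonglongrightarrow> 0"
    by simp
  then show ?thesis
    by (simp add: tendsto_rabs_zero_iff)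
qed

lemma (in prob_space) gaussian_AE_tendsto_zero:
  fixes X :: "nat \<Rightarrow> 'a \<Rightarrow> real"
  assumes X: "\<And>n. gaussian_rv M (X n)" "\<And>n. expectation (X n) = 0"
    and bound: "\<And>n. n \<ge> 1 \<Longrightarrow> expectation (\<lambda>\<omega>. (X n \<omega>)\<^sup>2) \<le> A * real n powr q" and "q < 0"
  shows "AE \<omega> in M. (\<lambda>n. X n \<omega>) \<longlonglongrightarrow> 0"
proof -
  \<comment> \<open>This k makes the 2k-th moments O(n^(kq)) with kq \<le> -2, hence
    summable.\<close>
  obtain k :: nat where "2 / (- q) < real k"
    using reals_Archimedean2 by blast
  then have k: "real k * q \<le> - 2"
    using \<open>q < 0\<close> by (simp add: field_simps)
  then have "k > 0" by (cases k) auto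
  define C :: real where "C = fact (2 * k) / (2 ^ k * fact k)"
  have "summable (\<lambda>n. C * A ^ k * real n powr - 2)"
    by (intro summable_mult) (simp add: summable_real_powr_iff)
  moreover have "norm (expectation (\<lambda>\<omega>. X n \<omega> ^ (2 * k))) \<le> C * A ^ k * real n powr - 2"
    if "n \<ge> 1" for n
  proof -
    have var: "0 \<le> expectation (\<lambda>\<omega>. (X n \<omega>)\<^sup>2)"
      by (intro integral_nonneg_AE) simp
    then have "0 \<le> A * real n powr q"
      using bound [OF that] by linarith
    then have A: "0 \<le> A"
      using that by (simp add: zero_le_mult_iff)
    have "norm (expectation (\<lambda>\<omega>. X n \<omega> ^ (2 * k))) = expectation (\<lambda>\<omega>. X n \<omega> ^ (2 * k))"
      by (simp add: integral_nonneg_AE)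
    also have "\<dots> = C * expectation (\<lambda>\<omega>. (X n \<omega>)\<^sup>2) ^ k"
      unfolding C_def by (rule expectation_gaussian_rv_even_power [OF X])
    also have "\<dots> \<le> C * (A * real n powr q) ^ k"
      using var bound [OF that] by (intro mult_left_mono power_mono) (auto simp: C_def)
    also have "\<dots> = C * A ^ k * real n powr (real k * q)"
      using that by (simp add: power_mult_distrib powr_power)
    also have "\<dots> \<le> C * A ^ k * real n powr - 2"
      using that k A by (intro mult_left_mono powr_mono) (auto simp: C_def)
    finally show ?thesis .
  qed
  ultimately have "summable (\<lambda>n. expectation (\<lambda>\<omega>. X n \<omega> ^ (2 * k)))"
    by (rule summable_comparison_test' [where N = 1])
  then have "AE \<omega> in M. (\<lambda>n. X n \<omega> ^ (2 * k)) \<longlonglongrightarrow> 0"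
    by (intro AE_tendsto_zero_if_summable_integral integrable_gaussian_rv_even_power X) auto
  then show ?thesis
    by eventually_elim (rule tendsto_zero_of_even_power [OF _ \<open>k > 0\<close>])
qed

section \<open>Linear combinations of values of a fractional Brownian motion\<close>

lemma (in prob_space) fbm_linear_combination:
  assumes fbm: "fractional_brownian_motion M H X"
    and I: "finite I" "inj_on t I" "\<And>i. i \<in> I \<Longrightarrow> 0 \<le> t i"
  shows "gaussian_rv M (\<lambda>\<omega>. \<Sum>i\<in>I. c i * X (t i) \<omega>)"
    and "expectation (\<lambda>\<omega>. \<Sum>i\<in>I. c i * X (t i) \<omega>) = 0"
    and "expectation (\<lambda>\<omega>. (\<Sum>i\<in>I. c i * X (t i) \<omega>)\<^sup>2) =
      (\<Sum>i\<in>I. \<Sum>j\<in>I. c i * c j * fbm_cov H (t i) (t j))"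
proof -
  have gauss: "gaussian_rv M (\<lambda>\<omega>. \<Sum>s\<in>J. d s * X s \<omega>)" if "finite J" "J \<subseteq> {0..}" for J d
    using fbm that unfolding fractional_brownian_motion_def gaussian_process_def by blast
  \<comment> \<open>\<open>gaussian_process\<close> speaks of sums over sets of times, so the
    indexed sum is transported along the injective \<open>t\<close>.\<close>
  have "gaussian_rv M (\<lambda>\<omega>. \<Sum>s\<in>t ` I. c (inv_into I t s) * X s \<omega>)"
    using I by (intro gauss) auto
  then show "gaussian_rv M (\<lambda>\<omega>. \<Sum>i\<in>I. c i * X (t i) \<omega>)"
    using I(2) by (simp add: sum.reindex)
  have gauss1: "gaussian_rv M (X s)" and mean: "expectation (X s) = 0" if "0 \<le> s" for s
    using gauss [of "{s}" "\<lambda>_. 1"] fbm that by (auto simp: fractional_brownian_motion_def)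
  \<comment> \<open>The prescribed means and covariances alone do not give integrability, since a
    nonintegrable function has integral 0; it is drawn from the Gaussian moments.\<close>
  have meas: "X s \<in> borel_measurable M" and sq: "integrable M (\<lambda>\<omega>. (X s \<omega>)\<^sup>2)" if "0 \<le> s" for s
    using gauss1 [OF that] integrable_gaussian_rv_even_power [OF gauss1 mean, OF that that, of 1]
    by (simp_all add: gaussian_rv_def)
  have int: "integrable M (X s)" if "0 \<le> s" for s
    using square_integrable_imp_integrable meas sq that by blast
  show "expectation (\<lambda>\<omega>. \<Sum>i\<in>I. c i * X (t i) \<omega>) = 0"
    using I(3) int mean by simp
  have int_prod: "integrable M (\<lambda>\<omega>. X s \<omega> * X u \<omega>)" if "0 \<le> s" "0 \<le> u" for s u
  proof (rule Bochner_Integration.integrable_bound)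
    show "integrable M (\<lambda>\<omega>. (X s \<omega>)\<^sup>2 + (X u \<omega>)\<^sup>2)"
      using sq that by simp
    show "(\<lambda>\<omega>. X s \<omega> * X u \<omega>) \<in> borel_measurable M"
      using meas [OF that(1)] meas [OF that(2)] by simp
    have "\<bar>x * y\<bar> \<le> x\<^sup>2 + y\<^sup>2" for x y :: real
      using sum_squares_bound [of "\<bar>x\<bar>" "\<bar>y\<bar>"] abs_ge_zero [of "x * y"]
      unfolding abs_mult power2_abs by linarith
    then show "AE \<omega> in M. norm (X s \<omega> * X u \<omega>) \<le> norm ((X s \<omega>)\<^sup>2 + (X u \<omega>)\<^sup>2)"
      by simp
  qed
  have cov: "expectation (\<lambda>\<omega>. X s \<omega> * X u \<omega>) = fbm_cov H s u" if "0 \<le> s" "0 \<le> u" for s u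
    using fbm that unfolding fractional_brownian_motion_def fbm_cov_def by auto
  have "(\<Sum>i\<in>I. c i * X (t i) \<omega>)\<^sup>2 =
      (\<Sum>i\<in>I. \<Sum>j\<in>I. c i * c j * (X (t i) \<omega> * X (t j) \<omega>))" for \<omega>
    by (simp add: power2_eq_square sum_product mult_ac)
  then show "expectation (\<lambda>\<omega>. (\<Sum>i\<in>I. c i * X (t i) \<omega>)\<^sup>2) =
      (\<Sum>i\<in>I. \<Sum>j\<in>I. c i * c j * fbm_cov H (t i) (t j))"
    using I(3) by (simp add: int_prod cov)
qed

section \<open>The estimation error\<close>

lemma mult_mat_vec_index_sq_le:
  fixes A :: "real mat"
  assumes A: "A \<in> carrier_mat n n" and sym: "transpose_mat A = A"
    and psd: "\<And>y. y \<in> carrier_vec n \<Longrightarrow> 0 \<le> y \<bullet> (A *\<^sub>v y)"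
    and x: "x \<in> carrier_vec n" and i: "i < n" and diag: "0 < A $$ (i, i)"
  shows "((A *\<^sub>v x) $ i)\<^sup>2 \<le> A $$ (i, i) * (x \<bullet> (A *\<^sub>v x))"
proof -
  \<comment> \<open>Positive semidefiniteness at \<open>d \<cdot>\<^sub>v x - t \<cdot>\<^sub>v e\<close>, the multiple of the minimiser of
    \<open>s \<mapsto> (x - s e) \<bullet> A (x - s e)\<close> that avoids division.\<close>
  define e where "e = (unit_vec n i :: real vec)"
  define t where "t = (A *\<^sub>v x) $ i"
  define d where "d = A $$ (i, i)"
  have e: "e \<in> carrier_vec n" by (simp add: e_def)
  have Ae: "A *\<^sub>v e \<in> carrier_vec n" and Ax: "A *\<^sub>v x \<in> carrier_vec n"
    using A x e by auto
  have eAx: "e \<bullet> (A *\<^sub>v x) = t"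
    unfolding e_def t_def using Ax i by simp
  moreover have "x \<bullet> (A *\<^sub>v e) = e \<bullet> (A *\<^sub>v x)"
    using transpose_vec_mult_scalar [OF A e x] comm_scalar_prod [OF Ax e] sym by simp
  moreover have "e \<bullet> (A *\<^sub>v e) = d"
    using A i by (simp add: e_def d_def)
  moreover have "0 \<le> (d \<cdot>\<^sub>v x - t \<cdot>\<^sub>v e) \<bullet> (A *\<^sub>v (d \<cdot>\<^sub>v x - t \<cdot>\<^sub>v e))"
    using x e by (intro psd) auto
  moreover have "A *\<^sub>v (d \<cdot>\<^sub>v x - t \<cdot>\<^sub>v e) = d \<cdot>\<^sub>v (A *\<^sub>v x) - t \<cdot>\<^sub>v (A *\<^sub>v e)"
    using A x e by (simp add: mult_minus_distrib_mat_vec mult_mat_vec)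
  \<comment> \<open>Expanding the form gives d^2 x.Ax - 2 d t^2 + t^2 d; dividing by d > 0 yields
    Cauchy-Schwarz for x and e.\<close>
  ultimately have "0 \<le> d * (d * (x \<bullet> (A *\<^sub>v x)) - t * t)"
    using x e Ae Ax
    by (simp add: minus_scalar_prod_distrib [where n = n] scalar_prod_minus_distrib [where n = n]
        smult_scalar_prod_distrib [where n = n] scalar_prod_smult_distrib [where n = n] algebra_simps)
  then show ?thesis
    using diag by (simp add: t_def d_def zero_le_mult_iff power2_eq_square)
qed

section \<open>The covariance matrix and its inverse\<close>

lemma cov_mat_carrier [simp]: "cov_mat h m H N \<in> carrier_mat N N"
  by (simp add: cov_mat_def)

lemma cov_mat_index:
  "i < N \<Longrightarrow> j < N \<Longrightarrow> cov_mat h m H N $$ (i, j) =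
    (\<Sum>r=1..m. fbm_cov (H r) (mesh_time h (Suc i)) (mesh_time h (Suc j)))"
  by (simp add: cov_mat_def Let_def fbm_cov_def sum_divide_distrib)

lemma transpose_cov_mat: "transpose_mat (cov_mat h m H N) = cov_mat h m H N"
  by (rule eq_matI)
    (auto simp: cov_mat_def Let_def abs_minus_commute add.commute intro!: sum.cong)

lemma cov_mat_quadratic_form:
  assumes "x \<in> carrier_vec N"
  shows "x \<bullet> (cov_mat h m H N *\<^sub>v x) =
    (\<Sum>r=1..m. \<Sum>i<N. \<Sum>j<N. x $ i * x $ j *
      fbm_cov (H r) (mesh_time h (Suc i)) (mesh_time h (Suc j)))"
proof -
  have "x \<bullet> (cov_mat h m H N *\<^sub>v x) =
      (\<Sum>i<N. \<Sum>j<N. \<Sum>r=1..m. x $ i * x $ j *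
      fbm_cov (H r) (mesh_time h (Suc i)) (mesh_time h (Suc j)))"
    using assms carrier_matD [OF cov_mat_carrier [of h m H N]]
    by (simp add: scalar_prod_def cov_mat_index sum_distrib_left sum_distrib_right mult_ac
        atLeast0LessThan)
  then show ?thesis
    unfolding sum.swap [of _ "{1..m}" "{..<N}"] .
qed

lemma cov_mat_pos_def:
  assumes "h > 0" "m \<ge> 1" and H: "\<forall>r\<in>{1..m}. 0 < H r \<and> H r < 1"
    and x: "x \<in> carrier_vec N" "x \<noteq> 0\<^sub>v N"
  shows "0 < x \<bullet> (cov_mat h m H N *\<^sub>v x)"
proof -
  obtain k where k: "k < N" "x $ k \<noteq> 0"
    using x by (metis carrier_vecD eq_vecI index_zero_vec)
  have "0 < H r" "H r < 1" if "r \<in> {1..m}" for r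
    using H that by auto
  then show ?thesis
    unfolding cov_mat_quadratic_form [OF x(1)]
    using \<open>m \<ge> 1\<close> \<open>h > 0\<close> k by (intro sum_pos fbm_cov_pos_def) auto
qed

text \<open>Positive definiteness leaves no nonzero kernel vector, so the determinant is nonzero.
  This ensures that \<open>the\<close> in \<open>theta_hat\<close> picks a genuine inverse.\<close>

lemma mat_inverse_cov_mat:
  assumes "h > 0" "m \<ge> 1" and H: "\<forall>r\<in>{1..m}. 0 < H r \<and> H r < 1"
  obtains G where "mat_inverse (cov_mat h m H N) = Some G" "G \<in> carrier_mat N N"
    "cov_mat h m H N * G = 1\<^sub>m N"
proof -
  have "Determinant.det (cov_mat h m H N) \<noteq> 0"
  proof
    assume "Determinant.det (cov_mat h m H N) = 0"
    then obtain v where v: "v \<in> carrier_vec N" "v \<noteq> 0\<^sub>v N" "cov_mat h m H N *\<^sub>v v = 0\<^sub>v N"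
      using det_0_iff_vec_prod_zero [OF cov_mat_carrier] by blast
    then show False
      using cov_mat_pos_def [OF assms v(1,2)] by simp
  qed
  then have "mat_inverse (cov_mat h m H N) \<noteq> None"
    \<comment> \<open>The parameter \<open>b\<close> only fills the extension slot of the matrix
      ring record; one common choice makes both facts refer to the same ring.\<close>
    using mat_inverse(1) [OF cov_mat_carrier, where b = "()"]
      det_non_zero_imp_unit [OF cov_mat_carrier, where b = "()"] by blast
  with that show thesis
    using mat_inverse(2) [OF cov_mat_carrier] by blast
qed

text \<open>The coefficients are chosen before \<theta>, \<alpha>, the processes and the outcome, so
  the error is a fixed linear combination of the observed noise and its variance can be
  computed.\<close>

lemma theta_hat_error:
  assumes h: "h > 0" and m: "m \<ge> 1" and H: "\<forall>r\<in>{1..m}. 0 < H r \<and> H r < 1"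
    and N: "N \<ge> 1"
  obtains c where
    "\<And>\<theta> \<alpha> B \<omega>. theta_hat h m H (drifted_mixed_fbm \<theta> \<alpha> m B) N \<omega> =
      \<theta> + \<alpha> * (\<Sum>r=1..m. \<Sum>i<N. c i * B r (mesh_time h (Suc i)) \<omega>)"
    "(\<Sum>r=1..m. \<Sum>i<N. \<Sum>j<N. c i * c j * fbm_cov (H r) (mesh_time h (Suc i)) (mesh_time h (Suc j)))
      \<le> (\<Sum>r=1..m. mesh_time h N powr (2 * H r - 2))"
proof -
  define A where "A = cov_mat h m H N"
  have A: "A \<in> carrier_mat N N" by (simp add: A_def)
  obtain G where G: "mat_inverse A = Some G" "G \<in> carrier_mat N N" "A * G = 1\<^sub>m N"
    using mat_inverse_cov_mat [OF h m H] unfolding A_def by blast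
  define T where "T = time_vec h N"
  define x where "x = G *\<^sub>v T"
  define D where "D = T \<bullet> x"
  have T: "T \<in> carrier_vec N" and x: "x \<in> carrier_vec N"
    using G by (auto simp: T_def x_def time_vec_def)
  have AG: "A *\<^sub>v (G *\<^sub>v v) = v" if "v \<in> carrier_vec N" for v
    using assoc_mult_mat_vec [OF A G(2) that] that by (simp add: G(3))
  \<comment> \<open>With T = A x and A symmetric, \<open>A\<close> moves to the right-hand factor
    and cancels \<open>G\<close>.\<close>
  have TG: "T \<bullet> (G *\<^sub>v v) = x \<bullet> v" if "v \<in> carrier_vec N" for v
  proof -
    have "T \<bullet> (G *\<^sub>v v) = (transpose_mat A *\<^sub>v x) \<bullet> (G *\<^sub>v v)"
      unfolding A_def transpose_cov_mat by (simp add: x_def AG [OF T, unfolded A_def])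
    also have "\<dots> = x \<bullet> (A *\<^sub>v (G *\<^sub>v v))"
      using A G(2) x that by (intro transpose_vec_mult_scalar) auto
    finally show ?thesis by (simp only: AG [OF that])
  qed
  have D: "D = x \<bullet> (A *\<^sub>v x)"
    unfolding D_def x_def AG [OF T] using x T by (intro comm_scalar_prod) (auto simp: x_def)
  have tN: "mesh_time h N > 0"
    using h N by (simp add: mesh_time_def)
  \<comment> \<open>Indices start at 0, so the last observation time sits at N - 1.\<close>
  have TN: "T $ (N - 1) = mesh_time h N"
    using N by (simp add: T_def time_vec_def)
  have "x \<noteq> 0\<^sub>v N"
  proof
    assume "x = 0\<^sub>v N"
    then have "A *\<^sub>v 0\<^sub>v N = T" using AG [OF T] by (simp add: x_def)
    then have "T = 0\<^sub>v N" using A by auto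
    then show False using TN tN N by simp
  qed
  then have D_pos: "D > 0"
    unfolding D A_def using x by (intro cov_mat_pos_def h m H)
  define d where "d = A $$ (N - 1, N - 1)"
  have d: "d = (\<Sum>r=1..m. mesh_time h N powr (2 * H r))"
    using N by (simp add: d_def A_def cov_mat_index fbm_cov_def)
  have d_pos: "d > 0"
    unfolding d using m tN by (intro sum_pos) auto
  have psd: "0 \<le> y \<bullet> (A *\<^sub>v y)" if "y \<in> carrier_vec N" for y
  proof (cases "y = 0\<^sub>v N")
    case True
    then show ?thesis
      using scalar_prod_left_zero [OF mult_mat_vec_carrier [OF A that]] by simp
  next
    case False
    then show ?thesis
      using cov_mat_pos_def [OF h m H that] by (simp add: A_def)
  qed
  \<comment> \<open>Cauchy-Schwarz at the last index: the entry of A x = T there is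
    \<open>mesh_time h N\<close>, and x.Ax = D.\<close>
  have "(mesh_time h N)\<^sup>2 \<le> d * D"
    using mult_mat_vec_index_sq_le [OF A _ psd x, of "N - 1"] N d_pos
    unfolding D d_def TN [symmetric] by (simp add: x_def AG T) (simp add: A_def transpose_cov_mat)
  then have "1 / D \<le> d / (mesh_time h N)\<^sup>2"
    using D_pos tN by (simp add: field_simps)
  also have "\<dots> = (\<Sum>r=1..m. mesh_time h N powr (2 * H r - 2))"
    using tN by (simp add: d sum_divide_distrib powr_diff)
  finally have bound: "1 / D \<le> (\<Sum>r=1..m. mesh_time h N powr (2 * H r - 2))" .
  define c where "c i = x $ i / D" for i
  show thesis
  proof (rule that [of c])
    fix \<theta> \<alpha> :: real and B :: "nat \<Rightarrow> real \<Rightarrow> 'b \<Rightarrow> real" and \<omega>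
    have c_sum: "(\<Sum>r=1..m. \<Sum>i<N. c i * B r (mesh_time h (Suc i)) \<omega>) =
        (\<Sum>r=1..m. \<Sum>i<N. x $ i * B r (mesh_time h (Suc i)) \<omega>) / D"
      by (simp add: c_def sum_divide_distrib)
    let ?Z = "obs_vec h (drifted_mixed_fbm \<theta> \<alpha> m B) N \<omega>"
    have "theta_hat h m H (drifted_mixed_fbm \<theta> \<alpha> m B) N \<omega> = (T \<bullet> (G *\<^sub>v ?Z)) / D"
      by (simp add: theta_hat_def Let_def G(1) flip: A_def T_def x_def D_def)
    also have "T \<bullet> (G *\<^sub>v ?Z) = x \<bullet> ?Z"
      by (intro TG) (simp add: obs_vec_def)
    \<comment> \<open>The drift contributes \<theta> x.T = \<theta> D, which becomes \<theta> after
      division by D.\<close>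
    also have "x \<bullet> ?Z = \<theta> * D + \<alpha> * (\<Sum>r=1..m. \<Sum>i<N. x $ i * B r (mesh_time h (Suc i)) \<omega>)"
    proof -
      have "D = (\<Sum>i<N. x $ i * mesh_time h (Suc i))"
        using comm_scalar_prod [OF T x]
        by (simp add: D_def T_def time_vec_def scalar_prod_def atLeast0LessThan)
      moreover have "(\<Sum>r=1..m. \<Sum>i<N. x $ i * B r (mesh_time h (Suc i)) \<omega>) =
          (\<Sum>i<N. x $ i * (\<Sum>r=1..m. B r (mesh_time h (Suc i)) \<omega>))"
        unfolding sum.swap [of _ "{1..m}" "{..<N}"] sum_distrib_left ..
      moreover have "x \<bullet> ?Z = (\<Sum>i<N. \<theta> * (x $ i * mesh_time h (Suc i)) +
          \<alpha> * (x $ i * (\<Sum>r=1..m. B r (mesh_time h (Suc i)) \<omega>)))"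
        by (simp add: scalar_prod_def obs_vec_def drifted_mixed_fbm_def atLeast0LessThan
            distrib_left mult.left_commute)
      ultimately show ?thesis
        by (simp only: sum.distrib sum_distrib_left [symmetric])
    qed
    finally show "theta_hat h m H (drifted_mixed_fbm \<theta> \<alpha> m B) N \<omega> =
      \<theta> + \<alpha> * (\<Sum>r=1..m. \<Sum>i<N. c i * B r (mesh_time h (Suc i)) \<omega>)"
      using D_pos c_sum by (simp add: add_divide_distrib)
  next
    \<comment> \<open>Since c = x / D, the form is x.Ax / D^2 = D / D^2.\<close>
    have "(\<Sum>r=1..m. \<Sum>i<N. \<Sum>j<N. c i * c j *
        fbm_cov (H r) (mesh_time h (Suc i)) (mesh_time h (Suc j))) = (x \<bullet> (A *\<^sub>v x)) / D\<^sup>2"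
      unfolding A_def cov_mat_quadratic_form [OF x]
      by (simp add: c_def sum_divide_distrib power2_eq_square)
    also have "\<dots> = 1 / D"
      using D_pos by (simp add: D [symmetric] power2_eq_square)
    finally show "(\<Sum>r=1..m. \<Sum>i<N. \<Sum>j<N. c i * c j *
        fbm_cov (H r) (mesh_time h (Suc i)) (mesh_time h (Suc j)))
      \<le> (\<Sum>r=1..m. mesh_time h N powr (2 * H r - 2))"
      using bound by simp
  qed
qed

section \<open>Strong consistency of the drift estimator\<close>

theorem theorem4p6:
  fixes M :: "'a measure" and h \<theta> \<alpha> :: real and m :: nat
    and H :: "nat \<Rightarrow> real" and B :: "nat \<Rightarrow> real \<Rightarrow> 'a \<Rightarrow> real"
  assumes "prob_space M"
    and "h > 0" and "m \<ge> 1" and "\<alpha> > 0"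
    and "\<And>r. r \<in> {1..m} \<Longrightarrow> 1 / 2 < H r \<and> H r < 1"
    and "\<And>r. r \<in> {1..m} \<Longrightarrow> fractional_brownian_motion M (H r) (B r)"
    and "independent_processes M {1..m} B"
  shows "AE \<omega> in M.
    (\<lambda>N. theta_hat h m H (drifted_mixed_fbm \<theta> \<alpha> m B) N \<omega>) \<longlonglongrightarrow> \<theta>"
proof -
  interpret prob_space M by fact
  have H: "\<forall>r\<in>{1..m}. 0 < H r \<and> H r < 1"
    using assms(5) by fastforce
  have "\<forall>N\<in>{1..}. \<exists>c. (\<forall>\<omega>. theta_hat h m H (drifted_mixed_fbm \<theta> \<alpha> m B) N \<omega> =
      \<theta> + \<alpha> * (\<Sum>r=1..m. \<Sum>i<N. c i * B r (mesh_time h (Suc i)) \<omega>)) \<and>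
    (\<Sum>r=1..m. \<Sum>i<N. \<Sum>j<N. c i * c j * fbm_cov (H r) (mesh_time h (Suc i)) (mesh_time h (Suc j)))
      \<le> (\<Sum>r=1..m. mesh_time h N powr (2 * H r - 2))"
    (is "\<forall>N\<in>_. ?P N")
  proof
    fix N :: nat assume "N \<in> {1..}"
    then have "N \<ge> 1" by simp
    show "?P N"
      by (rule theta_hat_error [OF \<open>h > 0\<close> \<open>m \<ge> 1\<close> H \<open>N \<ge> 1\<close>]) (intro exI conjI allI)
  qed
  from bchoice [OF this] obtain c where
    error: "\<And>N \<omega>. N \<ge> 1 \<Longrightarrow> theta_hat h m H (drifted_mixed_fbm \<theta> \<alpha> m B) N \<omega> =
      \<theta> + \<alpha> * (\<Sum>r=1..m. \<Sum>i<N. c N i * B r (mesh_time h (Suc i)) \<omega>)" and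
    var: "\<And>N. N \<ge> 1 \<Longrightarrow> (\<Sum>r=1..m. \<Sum>i<N. \<Sum>j<N. c N i * c N j *
        fbm_cov (H r) (mesh_time h (Suc i)) (mesh_time h (Suc j)))
      \<le> (\<Sum>r=1..m. mesh_time h N powr (2 * H r - 2))"
    by auto
  define X where "X r N \<omega> = (\<Sum>i<N. c N i * B r (mesh_time h (Suc i)) \<omega>)" for r N \<omega>
  \<comment> \<open>The slowest decay exponent among the processes; it is negative because every H r
    < 1 and the maximum is over a finite nonempty set.\<close>
  define q where "q = Max ((\<lambda>r. 2 * H r - 2) ` {1..m})"
  have "q < 0"
    using H \<open>m \<ge> 1\<close> unfolding q_def by (subst Max_less_iff) auto
  have q: "2 * H r - 2 \<le> q" if "r \<in> {1..m}" for r
    unfolding q_def using that by (intro Max_ge) auto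
  define A where "A = (\<Sum>r=1..m. h powr (2 * H r - 2))"
  have rate: "(\<Sum>r=1..m. mesh_time h N powr (2 * H r - 2)) \<le> A * real N powr q" if "N \<ge> 1" for N
    unfolding A_def sum_distrib_right
  proof (rule sum_mono)
    fix r assume "r \<in> {1..m}"
    then have "real N powr (2 * H r - 2) \<le> real N powr q"
      using that q by (intro powr_mono) auto
    then show "mesh_time h N powr (2 * H r - 2) \<le> h powr (2 * H r - 2) * real N powr q"
      using \<open>h > 0\<close> by (simp add: mesh_time_def powr_mult mult.commute mult_left_mono)
  qed
  have "AE \<omega> in M. (\<lambda>N. X r N \<omega>) \<longlonglongrightarrow> 0" if r: "r \<in> {1..m}" for r
  proof -
    have inj: "inj_on (\<lambda>i. mesh_time h (Suc i)) {..<N}" for N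
      using \<open>h > 0\<close> by (auto simp: inj_on_def mesh_time_def)
    have nonneg: "0 \<le> mesh_time h (Suc i)" for i
      using \<open>h > 0\<close> by (simp add: mesh_time_def)
    have X: "gaussian_rv M (X s N)" "expectation (X s N) = 0"
      "expectation (\<lambda>\<omega>. (X s N \<omega>)\<^sup>2) = (\<Sum>i<N. \<Sum>j<N. c N i * c N j *
        fbm_cov (H s) (mesh_time h (Suc i)) (mesh_time h (Suc j)))" if "s \<in> {1..m}" for s N
      using fbm_linear_combination [OF assms(6) [OF that] finite_lessThan inj nonneg,
        where c = "c N"]
      by (simp_all add: X_def [abs_def])
    show ?thesis
    proof (rule gaussian_AE_tendsto_zero [OF X(1,2) [OF r] _ \<open>q < 0\<close>])
      fix N :: nat assume N: "N \<ge> 1"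
      \<comment> \<open>Only the total of the variances is controlled; each single one is at most
        that total, all terms being nonnegative.\<close>
      have "expectation (\<lambda>\<omega>. (X r N \<omega>)\<^sup>2) \<le> (\<Sum>s=1..m. expectation (\<lambda>\<omega>. (X s N \<omega>)\<^sup>2))"
        using r by (intro member_le_sum integral_nonneg_AE) auto
      also have "\<dots> \<le> (\<Sum>s=1..m. mesh_time h N powr (2 * H s - 2))"
        using var [OF N] by (simp only: X(3) cong: sum.cong)
      also note rate [OF N]
      finally show "expectation (\<lambda>\<omega>. (X r N \<omega>)\<^sup>2) \<le> A * real N powr q" .
    qed
  qed
  then have "AE \<omega> in M. \<forall>r\<in>{1..m}. (\<lambda>N. X r N \<omega>) \<longlonglongrightarrow> 0"
    by (simp add: AE_ball_countable)
  then show ?thesis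
  proof eventually_elim
    fix \<omega> assume X: "\<forall>r\<in>{1..m}. (\<lambda>N. X r N \<omega>) \<longlonglongrightarrow> 0"
    have "(\<lambda>N. \<theta> + \<alpha> * (\<Sum>r=1..m. X r N \<omega>)) \<longlonglongrightarrow> \<theta> + \<alpha> * (\<Sum>r=1..m. 0)"
      using X by (intro tendsto_intros) auto
    \<comment> \<open>The error formula is available for N \<ge> 1 only, hence the equality is
      stated eventually.\<close>
    moreover have "\<forall>\<^sub>F N in sequentially. \<theta> + \<alpha> * (\<Sum>r=1..m. X r N \<omega>) =
        theta_hat h m H (drifted_mixed_fbm \<theta> \<alpha> m B) N \<omega>"
      using eventually_ge_at_top [of "1::nat"]
      by eventually_elim (simp add: error X_def)
    ultimately show "(\<lambda>N. theta_hat h m H (drifted_mixed_fbm \<theta> \<alpha> m B) N \<omega>) \<longlonglongrightarrow> \<theta>"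
      by (simp add: filterlim_cong [OF refl refl])
  qed
qed

end
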